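(* Let $g\in C^\infty(\mathbb{R})$ be strictly increasing with $g(0)=g'(0)=0$ and suppose there exists $\alpha>0$ such that $|g^{(j)}(t)|\lesssim(1+|t|)^{\alpha-j}$. Write $S(t)=e^{ig(t)\Delta}$. Let $I\subset\mathbb{R}$ be a finite interval centered at zero. Then for every $\epsilon>0$, every $N\ge1$ and every $\phi_N\in L^2(\mathbb{T}^2)$ with $\mathrm{supp}\,\widehat\phi_N\subseteq\{k\in\mathbb{Z}^2:|k|\le N\}$, $$\|g'(t)^{1/4}S(t)\phi_N\|_{L^4(I\times\mathbb{T}^2)}\lesssim N^{\epsilon}\|\phi_N\|_{L^2(\mathbb{T}^2)}.$$
   Context: $\mathbb{T}^2=(\mathbb{R}/2\pi\mathbb{Z})^2$. For $\phi$ on $\mathbb{T}^2$ with Fourier coefficients $\widehat\phi(k)$, $S(t)\phi(x)=\sum_{k\in\mathbb{Z}^2}e^{ik\cdot x}e^{-ig(t)|k|^2}\widehat\phi(k)$. The implicit constant may depend on $\epsilon,g,I$ but not on $N$ or $\phi_N$. *)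

theory Defs
  imports "HOL-Analysis.Analysis"
begin

definition smooth_fun :: "(real \<Rightarrow> real) \<Rightarrow> bool" where
  "smooth_fun g \<longleftrightarrow> (\<forall>j t. (deriv ^^ j) g differentiable at t)"

text \<open>Functions, not equivalence classes. The norm below is meaningful only for members of this
  space, because the Bochner integral of a non-integrable function is 0.\<close>

definition Lp_space :: "real \<Rightarrow> 'a measure \<Rightarrow> ('a \<Rightarrow> complex) set" where
  "Lp_space p M = {f. f \<in> borel_measurable M \<and> integrable M (\<lambda>x. norm (f x) powr p)}"

definition Lp_norm :: "real \<Rightarrow> 'a measure \<Rightarrow> ('a \<Rightarrow> complex) \<Rightarrow> real" where
  "Lp_norm p M f = (LINT x|M. norm (f x) powr p) powr (1 / p)"

text \<open>Functions on the torus \<open>(\<real>/2\<pi>\<int>)\<^sup>2\<close> are functions on the plane that are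
  \<open>2\<pi>\<close>-periodic in each variable; they are integrated over one period cell.\<close>

definition torus_cell :: "(real \<times> real) set" where
  "torus_cell = {0..<2 * pi} \<times> {0..<2 * pi}"

definition torus_periodic :: "(real \<times> real \<Rightarrow> complex) \<Rightarrow> bool" where
  "torus_periodic \<phi> \<longleftrightarrow>
     (\<forall>x y. \<phi> (x + 2 * pi, y) = \<phi> (x, y) \<and> \<phi> (x, y + 2 * pi) = \<phi> (x, y))"

definition L2_torus :: "(real \<times> real \<Rightarrow> complex) set" where
  "L2_torus = {\<phi>. torus_periodic \<phi> \<and> \<phi> \<in> Lp_space 2 (lebesgue_on torus_cell)}"

definition freq :: "int \<times> int \<Rightarrow> real \<times> real" where
  "freq k = (real_of_int (fst k), real_of_int (snd k))"

definition fourier_coeff :: "(real \<times> real \<Rightarrow> complex) \<Rightarrow> int \<times> int \<Rightarrow> complex" where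
  "fourier_coeff \<phi> k =
     (LINT x|lebesgue_on torus_cell. exp (- \<i> * complex_of_real (freq k \<bullet> x)) * \<phi> x)
       / complex_of_real ((2 * pi)\<^sup>2)"

text \<open>The propagator \<open>e\<^bsup>ig(t)\<Delta>\<^esup>\<close>. The series is taken pointwise (unconditionally), which is the
  intended meaning when only finitely many Fourier coefficients are nonzero; for general
  square-integrable \<open>\<phi>\<close> one would need convergence in \<open>L\<^sup>2\<close> instead.\<close>

definition propagator ::
  "(real \<Rightarrow> real) \<Rightarrow> real \<Rightarrow> (real \<times> real \<Rightarrow> complex) \<Rightarrow> real \<times> real \<Rightarrow> complex" where
  "propagator g t \<phi> x =
     (\<Sum>\<^sub>\<infinity>k\<in>UNIV. exp (\<i> * complex_of_real (freq k \<bullet> x))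
        * exp (- \<i> * complex_of_real (g t * (norm (freq k))\<^sup>2)) * fourier_coeff \<phi> k)"

end

theory Submission
  imports Defs "HOL-Computational_Algebra.Primes"
begin

text \<open>Since \<open>g' \<ge> 0\<close>, the weight \<open>g'(t)\<close> makes \<open>s = g(t)\<close> a change of variables, after which
  nonnegativity of the integrand allows the time interval to be enlarged to whole periods. There the
  fourth power of the \<open>L\<^sup>4\<close> norm of \<open>u\<close> is the squared \<open>L\<^sup>2\<close> norm of \<open>u\<^sup>2\<close>, and by orthogonality
  only quadruples with \<open>k + l = k' + l'\<close> and \<open>|k|\<^sup>2 + |l|\<^sup>2 = |k'|\<^sup>2 + |l'|\<^sup>2\<close> contribute. For given
  \<open>k, l\<close> these pairs correspond to lattice points on the circle \<open>|z|\<^sup>2 = |k - l|\<^sup>2\<close>, of which there are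
  at most \<open>O(N\<^sup>\<epsilon>)\<close> by the divisor bound. Bessel's inequality replaces the coefficients by \<open>\<phi>\<close>.\<close>

section \<open>The divisor bound\<close>

lemma card_le_fibres:
  assumes "finite A" "finite B" "f ` A \<subseteq> B"
    and fib: "\<And>b. b \<in> B \<Longrightarrow> card {a \<in> A. f a = b} \<le> c"
  shows "card A \<le> c * card B"
proof -
  have "A = (\<Union>b\<in>B. {a \<in> A. f a = b})" using assms(3) by auto
  then have "card A = card (\<Union>b\<in>B. {a \<in> A. f a = b})" by (rule arg_cong)
  also have "\<dots> \<le> (\<Sum>b\<in>B. card {a \<in> A. f a = b})"
    by (rule card_UN_le[OF assms(2)])
  also have "\<dots> \<le> c * card B"
    using sum_bounded_above[of B "\<lambda>b. card {a \<in> A. f a = b}" c] fib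
    by (simp add: mult.commute)
  finally show ?thesis .
qed

text \<open>At \<open>0\<close> the set of divisors is infinite and \<open>card\<close> returns its
  default value 0; the bounds below concern positive arguments.\<close>

definition num_divisors :: "nat \<Rightarrow> nat" where
  "num_divisors n = card {d. d dvd n}"

text \<open>Every divisor of \<open>a * b\<close> is a product of a divisor of \<open>a\<close> and
  a divisor of \<open>b\<close>, so multiplication maps the pairs onto the divisors of
  \<open>a * b\<close>.\<close>

lemma num_divisors_mult_le:
  assumes "a > 0" "b > 0"
  shows "num_divisors (a * b) \<le> num_divisors a * num_divisors b"
proof -
  have fin: "finite ({d. d dvd a} \<times> {d. d dvd b})" using assms by simp
  have "{d. d dvd a * b} \<subseteq> (\<lambda>(x, y). x * y) ` ({d. d dvd a} \<times> {d. d dvd b})"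
  proof
    fix d assume "d \<in> {d. d dvd a * b}"
    then have "d dvd a * b" by simp
    then obtain x y where "d = x * y" "x dvd a" "y dvd b" using division_decomp by blast
    then show "d \<in> (\<lambda>(x, y). x * y) ` ({d. d dvd a} \<times> {d. d dvd b})" by force
  qed
  then have "card {d. d dvd a * b} \<le> card ({d. d dvd a} \<times> {d. d dvd b})"
    using surj_card_le[OF fin] by blast
  then show ?thesis by (simp add: num_divisors_def card_cartesian_product)
qed

lemma num_divisors_mono:
  assumes "a dvd b" "b > 0"
  shows "num_divisors a \<le> num_divisors b"
  unfolding num_divisors_def
  by (rule card_mono) (use assms in \<open>auto intro: dvd_trans\<close>)

lemma num_divisors_prime_power:
  assumes "prime (p::nat)"
  shows "num_divisors (p ^ a) \<le> a + 1"
proof -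
  have "{d. d dvd p ^ a} \<subseteq> (\<lambda>i. p ^ i) ` {..a}"
    using assms divides_primepow_nat by auto
  then have "card {d. d dvd p ^ a} \<le> card {..a}" by (rule surj_card_le[rotated]) simp
  then show ?thesis by (simp add: num_divisors_def)
qed

text \<open>From \<open>exp x \<ge> 1 + x\<close> at \<open>x = a * \<epsilon> * ln 2\<close>. It
  pays for the factor \<open>a + 1\<close> of a small prime \<open>p\<close>, as
  \<open>p powr (a * \<epsilon>)\<close> is at least \<open>2 powr (a * \<epsilon>)\<close>.\<close>

lemma linear_le_exponential:
  fixes \<epsilon> :: real
  assumes "\<epsilon> > 0"
  obtains K :: real where "K \<ge> 1" "\<And>a::nat. real a + 1 \<le> K * 2 powr (a * \<epsilon>)"
proof
  define K where "K = 1 + 1 / (\<epsilon> * ln 2)"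
  show "K \<ge> 1" using assms by (simp add: K_def)
  fix a :: nat
  have e: "1 + a * \<epsilon> * ln 2 \<le> 2 powr (a * \<epsilon>)"
    using exp_ge_add_one_self[of "a * \<epsilon> * ln 2"] by (simp add: powr_def)
  have "real a + 1 \<le> K * (1 + a * \<epsilon> * ln 2)"
    using assms by (simp add: K_def field_simps)
  also have "\<dots> \<le> K * 2 powr (a * \<epsilon>)"
    by (rule mult_left_mono[OF e]) (use \<open>K \<ge> 1\<close> in simp)
  finally show "real a + 1 \<le> K * 2 powr (a * \<epsilon>)" .
qed

text \<open>Prime powers \<open>p ^ a\<close> are split off one prime at a time, each costing a
  factor of at most \<open>a + 1\<close>. If \<open>p\<close> is at least
  \<open>2 powr (1 / \<epsilon>)\<close>, then
  \<open>a + 1 \<le> 2 ^ a \<le> p powr (a * \<epsilon>)\<close> and nothing is lost; each of the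
  finitely many smaller primes loses one factor \<open>K\<close>.\<close>

lemma num_divisors_bound:
  fixes \<epsilon> :: real
  assumes eps: "\<epsilon> > 0"
  obtains C :: real where "C \<ge> 1" "\<And>n. n > 0 \<Longrightarrow> num_divisors n \<le> C * real n powr \<epsilon>"
proof -
  obtain K :: real where K: "K \<ge> 1" "\<And>a::nat. real a + 1 \<le> K * 2 powr (a * \<epsilon>)"
    using linear_le_exponential[OF eps] by blast
  \<comment> \<open>All natural numbers below the threshold, prime or not: finiteness is what
    counts, and \<open>K \<ge> 1\<close> makes surplus members harmless.\<close>
  define P where "P = {p::nat. real p < 2 powr (1 / \<epsilon>)}"
  have finP: "finite P"
  proof (rule finite_subset)
    show "P \<subseteq> {..nat \<lceil>2 powr (1 / \<epsilon>)\<rceil>}"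
      unfolding P_def by (auto, linarith)
  qed simp
  \<comment> \<open>Counting the members of \<open>P\<close> that divide \<open>n\<close> lets the
    induction spend one factor \<open>K\<close> whenever it removes a small prime.\<close>
  have main: "num_divisors n \<le> K ^ card {p \<in> P. p dvd n} * real n powr \<epsilon>" if "n > 0" for n
    using that
  proof (induction n rule: less_induct)
    case (less n)
    show ?case
    proof (cases "n = 1")
      case True
      then have "num_divisors n = 1" by (simp add: num_divisors_def)
      then show ?thesis using True K(1) by simp
    next
      case False
      then obtain p where p: "prime p" "p dvd n" using prime_factor_nat by blast
      define a where "a = multiplicity p n"
      obtain m where m: "n = p ^ a * m" "\<not> p dvd m"
        using multiplicity_decompose'[of n p] p less.prems unfolding a_def
        by (metis not_prime_unit less_not_refl)
      have a0: "a > 0" using m p by (cases a) auto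
      have m0: "m > 0" using m less.prems by (cases m) auto
      have "p ^ a > 1" using a0 p by (metis one_less_power prime_gt_1_nat)
      then have "m < n" using m m0 by simp
      then have IH: "num_divisors m \<le> K ^ card {q \<in> P. q dvd m} * real m powr \<epsilon>"
        using less.IH m0 by blast
      have p0: "real p > 0" using p by (simp add: prime_gt_0_nat)
      have p2: "real p \<ge> 2" using p prime_ge_2_nat by force
      have np: "real n powr \<epsilon> = real p powr (a * \<epsilon>) * real m powr \<epsilon>"
        using p0 m0 by (simp add: m(1) powr_mult powr_powr flip: powr_realpow)
      have "num_divisors n \<le> num_divisors (p ^ a) * num_divisors m"
        using m(1) num_divisors_mult_le[of "p ^ a" m] p m0 by (simp add: prime_gt_0_nat)
      also have "\<dots> \<le> (a + 1) * num_divisors m"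
        using num_divisors_prime_power[OF p(1)] by (intro mult_right_mono) auto
      finally have d: "real (num_divisors n) \<le> (real a + 1) * num_divisors m"
        by (metis of_nat_mono of_nat_mult of_nat_add of_nat_1)
      have sub: "{q \<in> P. q dvd m} \<subseteq> {q \<in> P. q dvd n}" using m(1) by auto
      have "(real a + 1) * K ^ card {q \<in> P. q dvd m} \<le> real p powr (a * \<epsilon>) * K ^ card {q \<in> P. q dvd n}"
      proof (cases "p \<in> P")
        case True
        \<comment> \<open>The whole power of \<open>p\<close> has been removed, so \<open>p\<close>
          divides \<open>n\<close> but not \<open>m\<close>; the exponent of \<open>K\<close> grows
          by at least one.\<close>
        have "{q \<in> P. q dvd m} \<subset> {q \<in> P. q dvd n}" using sub True p m(2) by auto
        then have "Suc (card {q \<in> P. q dvd m}) \<le> card {q \<in> P. q dvd n}"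
          using finP by (simp add: psubset_card_mono Suc_leI)
        then have "K ^ Suc (card {q \<in> P. q dvd m}) \<le> K ^ card {q \<in> P. q dvd n}"
          using K(1) by (rule power_increasing)
        moreover have "real a + 1 \<le> K * real p powr (a * \<epsilon>)"
        proof -
          have "2 powr (a * \<epsilon>) \<le> real p powr (a * \<epsilon>)"
            using p2 eps by (intro powr_mono2) auto
          then show ?thesis using K(2)[of a] K(1) mult_left_mono[of "2 powr (a * \<epsilon>)" "real p powr (a * \<epsilon>)" K] by linarith
        qed
        then have "(real a + 1) * K ^ card {q \<in> P. q dvd m} \<le> (K * real p powr (a * \<epsilon>)) * K ^ card {q \<in> P. q dvd m}"
          using K(1) by (intro mult_right_mono) auto
        ultimately show ?thesis
          using mult_left_mono[of "K ^ Suc (card {q \<in> P. q dvd m})" "K ^ card {q \<in> P. q dvd n}" "real p powr (a * \<epsilon>)"]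
          by (simp add: mult_ac)
      next
        case False
        then have "2 powr (1 / \<epsilon>) \<le> real p" by (simp add: P_def)
        then have "(2 powr (1 / \<epsilon>)) powr (a * \<epsilon>) \<le> real p powr (a * \<epsilon>)"
          using eps by (intro powr_mono2) auto
        then have "2 ^ a \<le> real p powr (a * \<epsilon>)"
          using eps by (simp add: powr_powr powr_realpow)
        moreover have "real a + 1 \<le> 2 ^ a"
          using Suc_leI[OF less_exp[of a]]
          by (metis Suc_eq_plus1 of_nat_1 of_nat_add of_nat_mono of_nat_numeral of_nat_power)
        moreover have "K ^ card {q \<in> P. q dvd m} \<le> K ^ card {q \<in> P. q dvd n}"
          using K(1) sub finP by (intro power_increasing card_mono) auto
        ultimately show ?thesis using K(1) by (intro mult_mono) auto
      qed
      then have step: "(real a + 1) * K ^ card {q \<in> P. q dvd m} * real m powr \<epsilon>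
          \<le> real p powr (a * \<epsilon>) * K ^ card {q \<in> P. q dvd n} * real m powr \<epsilon>"
        by (intro mult_right_mono) auto
      note d
      also have "(real a + 1) * num_divisors m \<le> (real a + 1) * (K ^ card {q \<in> P. q dvd m} * real m powr \<epsilon>)"
        using IH by (intro mult_left_mono) auto
      also have "\<dots> \<le> K ^ card {q \<in> P. q dvd n} * real n powr \<epsilon>"
        using step unfolding np by (simp only: mult_ac)
      finally show ?thesis .
    qed
  qed
  show thesis
  proof
    show "K ^ card P \<ge> 1" using K(1) by simp
    fix n :: nat assume "n > 0"
    have "K ^ card {p \<in> P. p dvd n} \<le> K ^ card P"
      using K(1) finP by (intro power_increasing card_mono) auto
    then have "K ^ card {p \<in> P. p dvd n} * real n powr \<epsilon> \<le> K ^ card P * real n powr \<epsilon>"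
      by (intro mult_right_mono) auto
    with main[OF \<open>n > 0\<close>] show "num_divisors n \<le> K ^ card P * real n powr \<epsilon>"
      by linarith
  qed
qed

section \<open>Lattice points on circles\<close>

definition circle_points :: "int \<Rightarrow> (int \<times> int) set" where
  "circle_points n = {(x, y). x\<^sup>2 + y\<^sup>2 = n}"

lemma abs_le_of_sum_squares:
  assumes "(x::int)\<^sup>2 + y\<^sup>2 = n" shows "\<bar>x\<bar> \<le> n"
proof -
  have "\<bar>x\<bar> \<le> x\<^sup>2"
    using self_le_power[of "\<bar>x\<bar>" 2] by (cases "x = 0") auto
  then show ?thesis using assms zero_le_power2[of y] by linarith
qed

lemma finite_circle_points: "finite (circle_points n)"
proof (rule finite_subset)
  show "circle_points n \<subseteq> {-n..n} \<times> {-n..n}"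
  proof
    fix v assume "v \<in> circle_points n"
    then obtain x y where "v = (x, y)" "x\<^sup>2 + y\<^sup>2 = n" by (auto simp: circle_points_def)
    moreover have "\<bar>x\<bar> \<le> n" "\<bar>y\<bar> \<le> n"
      using abs_le_of_sum_squares[of x y n] abs_le_of_sum_squares[of y x n] calculation
      by (auto simp: add.commute)
    ultimately show "v \<in> {-n..n} \<times> {-n..n}" by auto
  qed
qed auto

text \<open>A common factor of \<open>x\<close> and \<open>n\<close> would also be one of
  \<open>x\<close> and \<open>y\<^sup>2\<close>, and likewise for \<open>y\<close>. Hence
  coordinates of a primitive point can be cancelled in divisibilities by divisors of
  \<open>n\<close>.\<close>

lemma coprime_sum_squares:
  assumes "coprime (x::int) y" "x\<^sup>2 + y\<^sup>2 = n"
  shows "coprime x n" "coprime y n"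
proof -
  have "coprime x (y\<^sup>2)" "coprime y (x\<^sup>2)"
    using assms(1) by (auto simp: coprime_commute)
  moreover have "n = x * x + y\<^sup>2" "n = y * y + x\<^sup>2"
    using assms(2) by (auto simp: power2_eq_square)
  ultimately show "coprime x n" "coprime y n"
    by (metis coprime_iff_gcd_eq_1 gcd_add_mult)+
qed

text \<open>For two points on the circle, \<open>n\<close> divides the product of \<open>x y\<^sub>0 - x\<^sub>0 y\<close> and
  \<open>x y\<^sub>0 + x\<^sub>0 y\<close>; which divisor of \<open>n\<close> falls into the first factor classifies the point relative to
  \<open>(x\<^sub>0, y\<^sub>0)\<close> up to boundedly many choices. This replaces unique factorisation in the Gaussian
  integers.\<close>

lemma primitive_points_same_gcd:
  fixes n :: int
  assumes n: "n > 0"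
    and v0: "coprime x0 y0" "x0\<^sup>2 + y0\<^sup>2 = n"
    and v: "coprime x y" "x\<^sup>2 + y\<^sup>2 = n"
    and w: "coprime x' y'" "x'\<^sup>2 + y'\<^sup>2 = n"
    and d: "gcd (x * y0 - x0 * y) n = d" "gcd (x' * y0 - x0 * y') n = d"
  shows "n dvd 2 * (x * y' - x' * y)"
proof -
  \<comment> \<open>On the circle the squares of \<open>a * y0\<close> and \<open>x0 * b\<close>
    differ by a multiple of \<open>n\<close>. Once \<open>d\<close>, the part of \<open>n\<close>
    shared with the first factor, is divided out, \<open>n div d\<close> is coprime to the quotient
    and must divide the second factor.\<close>
  have key: "n div d dvd a * y0 + x0 * b" if "a\<^sup>2 + b\<^sup>2 = n" "gcd (a * y0 - x0 * b) n = d" for a b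
  proof -
    have "(a * y0 - x0 * b) * (a * y0 + x0 * b) = a\<^sup>2 * y0\<^sup>2 - x0\<^sup>2 * b\<^sup>2"
      by (simp add: algebra_simps power2_eq_square)
    also have "\<dots> = (n - b\<^sup>2) * y0\<^sup>2 - (n - y0\<^sup>2) * b\<^sup>2"
      using that(1) v0(2) by (metis add_diff_cancel_right')
    also have "\<dots> = n * (y0\<^sup>2 - b\<^sup>2)" by (simp add: algebra_simps)
    finally have "n dvd (a * y0 - x0 * b) * (a * y0 + x0 * b)" by simp
    moreover have g: "d \<noteq> 0" "d dvd n" "d dvd a * y0 - x0 * b" using that n by auto
    ultimately have "n div d dvd ((a * y0 - x0 * b) div d) * (a * y0 + x0 * b)"
      by (metis div_dvd_div div_mult_swap dvd_mult2 mult.commute)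
    moreover have "coprime ((a * y0 - x0 * b) div d) (n div d)"
      using that n by (metis div_gcd_coprime less_int_code(1))
    ultimately show ?thesis
      by (simp add: coprime_commute coprime_dvd_mult_right_iff)
  qed
  define e where "e = n div d"
  have dn: "d dvd n" using d by auto
  then have ne: "n = d * e" by (simp add: e_def)
  have e1: "e dvd x * y0 + x0 * y" "e dvd x' * y0 + x0 * y'"
    using key v w d by (auto simp: e_def)
  have d1: "d dvd x * y0 - x0 * y" "d dvd x' * y0 - x0 * y'" using d by (metis gcd_dvd1)+
  have cy0: "coprime y0 n" and cx: "coprime x n" using coprime_sum_squares v0 v by blast+
  \<comment> \<open>This combination eliminates \<open>x0\<close>; the remaining factor
    \<open>y0\<close> is coprime to \<open>n\<close> and cancels. The same works for
    \<open>e\<close> below.\<close>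
  have "d dvd y' * (x * y0 - x0 * y) - y * (x' * y0 - x0 * y')"
    by (rule dvd_diff[OF dvd_mult[OF d1(1)] dvd_mult[OF d1(2)]])
  also have "\<dots> = y0 * (x * y' - x' * y)" by (simp add: algebra_simps)
  finally have dd: "d dvd x * y' - x' * y"
    using cy0 dn by (meson coprime_commute coprime_dvd_mult_right_iff coprime_divisors dvd_refl)
  have "e dvd y' * (x * y0 + x0 * y) - y * (x' * y0 + x0 * y')"
    by (rule dvd_diff[OF dvd_mult[OF e1(1)] dvd_mult[OF e1(2)]])
  also have "\<dots> = y0 * (x * y' - x' * y)" by (simp add: algebra_simps)
  finally have ee: "e dvd x * y' - x' * y"
    using cy0 ne
    by (meson coprime_commute coprime_dvd_mult_right_iff coprime_divisors dvd_refl dvd_triv_right)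
  \<comment> \<open>The lcm of \<open>d\<close> and \<open>e\<close> falls short of \<open>n\<close>
    by the factor \<open>h\<close>. As \<open>h\<close> divides \<open>x * y0 * 2\<close> with
    \<open>x\<close> and \<open>y0\<close> coprime to \<open>n\<close>, it divides 2; this is the
    source of the 2 in the conclusion.\<close>
  define h where "h = gcd d e"
  have hn: "h dvd n" using ne by (simp add: h_def)
  have "h dvd (x * y0 - x0 * y) + (x * y0 + x0 * y)"
    using d1 e1 unfolding h_def by (meson dvd_add dvd_trans gcd_dvd1 gcd_dvd2)
  also have "\<dots> = (x * y0) * 2" by simp
  finally have "h dvd (x * y0) * 2" .
  moreover have "coprime h (x * y0)"
    using cx cy0 hn by (meson coprime_commute coprime_divisors coprime_mult_left_iff dvd_refl)
  ultimately have "h dvd 2" by (simp add: coprime_dvd_mult_right_iff)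
  moreover have "lcm d e dvd x * y' - x' * y" using dd ee by (rule lcm_least)
  ultimately have "h * lcm d e dvd 2 * (x * y' - x' * y)" by (rule mult_dvd_mono)
  moreover have "h * lcm d e = \<bar>n\<bar>"
    unfolding h_def ne using prod_gcd_lcm_int[of d e] by (simp add: abs_mult)
  ultimately show ?thesis by simp
qed

text \<open>The gcd relative to a fixed point \<open>(x0, y0)\<close> sorts the points by divisors
  of \<open>n\<close>. Within a class, twice the determinant with a base point is a multiple of
  \<open>n\<close> of size at most \<open>2 * n\<close>, which leaves 5 values; the inner product
  with the base point is then known up to sign, with 3 values of \<open>sgn\<close>. Hence 15 = 5 *
  3.\<close>

lemma card_primitive_circle_points:
  fixes n :: nat
  assumes n: "n > 0"
  shows "card {(x, y) \<in> circle_points n. coprime x y} \<le> 15 * num_divisors n"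
proof (cases "{(x, y) \<in> circle_points n. coprime x y} = {}")
  case False
  define A where "A = {(x, y) \<in> circle_points n. coprime x y}"
  from False obtain x0 y0 where v0: "coprime x0 y0" "x0\<^sup>2 + y0\<^sup>2 = int n"
    by (auto simp: circle_points_def)
  define f where "f = (\<lambda>(x, y). nat (gcd (x * y0 - x0 * y) (int n)))"
  have finA: "finite A" unfolding A_def
    by (rule finite_subset[OF _ finite_circle_points[of "int n"]]) auto
  have "card {a \<in> A. f a = d} \<le> 15" for d
  proof (cases "{a \<in> A. f a = d} = {}")
    case False
    then obtain x y where v: "coprime x y" "x\<^sup>2 + y\<^sup>2 = int n" "f (x, y) = d"
      by (auto simp: A_def circle_points_def)
    define h where "h = (\<lambda>(x', y'). (2 * (x * y' - x' * y), sgn (x * x' + y * y')))"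
    define B where "B = {-2 * int n, - int n, 0, int n, 2 * int n} \<times> {-1, 0, 1::int}"
    \<comment> \<open>Lagrange's identity: it bounds the determinant by \<open>n\<close> and, once
      the determinant is known, fixes the inner product up to sign.\<close>
    have lag: "(x * y' - x' * y)\<^sup>2 + (x * x' + y * y')\<^sup>2 = (int n)\<^sup>2" if "x'\<^sup>2 + y'\<^sup>2 = int n" for x' y'
    proof -
      have "(x * y' - x' * y)\<^sup>2 + (x * x' + y * y')\<^sup>2 = (x\<^sup>2 + y\<^sup>2) * (x'\<^sup>2 + y'\<^sup>2)"
        by (simp add: algebra_simps power2_eq_square)
      then show ?thesis using v that by (simp add: power2_eq_square)
    qed
    have "h ` {a \<in> A. f a = d} \<subseteq> B"
    proof (rule image_subsetI)
      fix v assume "v \<in> {a \<in> A. f a = d}"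
      then obtain x' y' where v': "v = (x', y')" and a: "(x', y') \<in> A" "f (x', y') = d"
        by (cases v) auto
      then have w: "coprime x' y'" "x'\<^sup>2 + y'\<^sup>2 = int n"
        by (auto simp: A_def circle_points_def)
      have g: "gcd (x * y0 - x0 * y) (int n) = int d" "gcd (x' * y0 - x0 * y') (int n) = int d"
        using v(3) a(2) by (simp_all add: f_def nat_eq_iff)
      have "int n dvd 2 * (x * y' - x' * y)"
        using primitive_points_same_gcd[OF _ v0 v(1,2) w g] n by simp
      then obtain q where q: "2 * (x * y' - x' * y) = int n * q" by (auto simp: dvd_def)
      have "(x * y' - x' * y)\<^sup>2 \<le> (int n)\<^sup>2"
        using lag[OF w(2)] zero_le_power2[of "x * x' + y * y'"] by linarith
      then have "\<bar>x * y' - x' * y\<bar> \<le> int n"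
        by (simp add: abs_le_square_iff[symmetric])
      then have "\<bar>int n * q\<bar> \<le> int n * 2" unfolding q[symmetric] abs_mult by simp
      then have "\<bar>q\<bar> \<le> 2" using n by (simp add: abs_mult)
      then have "q \<in> {-2, -1, 0, 1, 2}" by auto
      then show "h v \<in> B" using q by (auto simp: v' h_def B_def sgn_if)
    qed
    moreover have "inj_on h {a \<in> A. f a = d}"
    proof (rule inj_onI, clarify)
      fix x1 y1 x2 y2
      assume "(x1, y1) \<in> A" "(x2, y2) \<in> A" and eq: "h (x1, y1) = h (x2, y2)"
      then have w: "x1\<^sup>2 + y1\<^sup>2 = int n" "x2\<^sup>2 + y2\<^sup>2 = int n"
        by (auto simp: A_def circle_points_def)
      have e1: "x * y1 - x1 * y = x * y2 - x2 * y" and e2: "sgn (x * x1 + y * y1) = sgn (x * x2 + y * y2)"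
        using eq by (auto simp: h_def)
      have "(x * x1 + y * y1)\<^sup>2 = (x * x2 + y * y2)\<^sup>2"
        using lag[OF w(1)] lag[OF w(2)] e1 by simp
      then have "\<bar>x * x1 + y * y1\<bar> = \<bar>x * x2 + y * y2\<bar>"
        by (simp add: power2_eq_iff abs_eq_iff)
      with e2 have e3: "x * x1 + y * y1 = x * x2 + y * y2" by (metis sgn_mult_abs)
      \<comment> \<open>Determinant and inner product with \<open>(x, y)\<close> are linear in the
        point; these formulas invert them up to the factor \<open>n\<close>.\<close>
      have "int n * x1 = x * (x * x1 + y * y1) - y * (x * y1 - x1 * y)"
        "int n * x2 = x * (x * x2 + y * y2) - y * (x * y2 - x2 * y)"
        "int n * y1 = y * (x * x1 + y * y1) + x * (x * y1 - x1 * y)"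
        "int n * y2 = y * (x * x2 + y * y2) + x * (x * y2 - x2 * y)"
        unfolding v(2)[symmetric] by (simp_all add: algebra_simps power2_eq_square)
      then have "int n * x1 = int n * x2" "int n * y1 = int n * y2" using e1 e3 by auto
      then show "x1 = x2 \<and> y1 = y2" using n by simp
    qed
    moreover have "finite B" by (simp add: B_def)
    ultimately have "card {a \<in> A. f a = d} \<le> card B" using card_inj_on_le by blast
    also have "card B \<le> 15" using n by (simp add: B_def card_cartesian_product)
    finally show ?thesis .
  next
    case True
    then show ?thesis by (simp only: card.empty)
  qed
  moreover have "f ` A \<subseteq> {d. d dvd n}"
    by (auto simp: f_def nat_dvd_iff)
  moreover have "finite {d. d dvd n}" using n by simp
  ultimately have "card A \<le> 15 * card {d. d dvd n}" using card_le_fibres[OF finA] by metis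
  then show ?thesis by (simp add: A_def num_divisors_def)
qed (simp only: card.empty)

text \<open>Points are sorted by the gcd \<open>d\<close> of their coordinates. Division by
  \<open>d\<close> makes them primitive points on the circle for \<open>n div d\<^sup>2\<close>,
  which has at most as many divisors as \<open>n\<close>; the second divisor count bounds the
  choices of \<open>d\<close>.\<close>

lemma card_circle_points:
  fixes n :: nat
  assumes n: "n > 0"
  shows "card (circle_points n) \<le> 15 * num_divisors n * num_divisors n"
proof -
  define f where "f = (\<lambda>(x::int, y). nat (gcd x y))"
  have sq: "(gcd x y)\<^sup>2 dvd int n" if "x\<^sup>2 + y\<^sup>2 = int n" for x y
    using that by (metis dvd_add dvd_power_same gcd_dvd1 gcd_dvd2)
  have "card {a \<in> circle_points n. f a = d} \<le> 15 * num_divisors n" if "d \<in> {d. d dvd n}" for d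
  proof (cases "{a \<in> circle_points n. f a = d} = {}")
    case False
    have d0: "d > 0" using that n by (auto intro: dvd_pos_nat)
    have "(int d)\<^sup>2 dvd int n" using False sq by (force simp: f_def circle_points_def)
    then have dn: "d\<^sup>2 dvd n" by (metis of_nat_dvd_iff of_nat_power)
    define m where "m = n div d\<^sup>2"
    have nm: "n = d\<^sup>2 * m" using dn by (simp add: m_def)
    then have m0: "m > 0" using n by (cases m) auto
    have "{a \<in> circle_points n. f a = d} \<subseteq>
        (\<lambda>(x, y). (int d * x, int d * y)) ` {(x, y) \<in> circle_points m. coprime x y}"
    proof
      fix v assume "v \<in> {a \<in> circle_points n. f a = d}"
      then obtain x y where v: "v = (x, y)" and a: "(x, y) \<in> circle_points n" "f (x, y) = d"
        by (cases v) auto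
      have gd: "gcd x y = int d" using a by (auto simp: f_def)
      obtain x1 y1 where xy: "x = x1 * int d" "y = y1 * int d" "coprime x1 y1"
        using gcd_coprime_exists[of x y] gd d0 by auto
      have "(int d)\<^sup>2 * (x1\<^sup>2 + y1\<^sup>2) = (int d)\<^sup>2 * int m"
        using a(1) nm by (simp add: circle_points_def xy(1,2) algebra_simps power_mult_distrib)
      then have "x1\<^sup>2 + y1\<^sup>2 = int m" using d0 by simp
      then have "(x1, y1) \<in> {(x, y) \<in> circle_points m. coprime x y}"
        using xy by (simp add: circle_points_def)
      then show "v \<in> (\<lambda>(x, y). (int d * x, int d * y)) ` {(x, y) \<in> circle_points m. coprime x y}"
        by (rule rev_image_eqI) (simp add: v xy mult.commute)
    qed
    moreover have "finite {(x, y) \<in> circle_points m. coprime x y}"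
      by (rule finite_subset[OF _ finite_circle_points[of "int m"]]) auto
    ultimately have "card {a \<in> circle_points n. f a = d} \<le> card {(x, y) \<in> circle_points m. coprime x y}"
      by (rule surj_card_le[rotated])
    also have "\<dots> \<le> 15 * num_divisors m" by (rule card_primitive_circle_points[OF m0])
    also have "\<dots> \<le> 15 * num_divisors n" using num_divisors_mono[of m n] nm n by simp
    finally show ?thesis .
  next
    case True
    then show ?thesis by (simp only: card.empty)
  qed
  moreover have "f ` circle_points n \<subseteq> {d. d dvd n}"
  proof (clarify)
    fix x y assume "(x, y) \<in> circle_points n"
    then have "(gcd x y)\<^sup>2 dvd int n" using sq by (simp add: circle_points_def)
    then have "gcd x y dvd int n" by (rule dvd_trans[rotated]) simp
    then show "f (x, y) dvd n" by (simp add: f_def nat_dvd_iff)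
  qed
  moreover have "finite {d. d dvd n}" using n by simp
  ultimately have "card (circle_points n) \<le> 15 * num_divisors n * card {d. d dvd n}"
    using card_le_fibres[OF finite_circle_points] by metis
  then show ?thesis by (simp add: num_divisors_def)
qed

text \<open>The divisor bound with exponent \<open>\<epsilon> / 2\<close> is used squared. Bounding
  by \<open>R \<ge> 1\<close> rather than by \<open>n\<close> includes the degenerate circle
  \<open>n = 0\<close>, a single point, which arises from pairs with \<open>k = l\<close>.\<close>

lemma card_circle_points_bound:
  assumes "\<epsilon> > 0"
  obtains C :: real where "C \<ge> 1"
    "\<And>n R. 0 \<le> n \<Longrightarrow> real_of_int n \<le> R \<Longrightarrow> 1 \<le> R \<Longrightarrow> card (circle_points n) \<le> C * R powr \<epsilon>"
proof -
  obtain D :: real where D: "D \<ge> 1" "\<And>n. n > 0 \<Longrightarrow> num_divisors n \<le> D * real n powr (\<epsilon> / 2)"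
    using num_divisors_bound[of "\<epsilon> / 2"] assms by auto
  show thesis
  proof
    show C1: "15 * D\<^sup>2 \<ge> 1" using D(1) one_le_power[of D 2] by linarith
    fix n :: int and R :: real
    assume nn: "0 \<le> n" "real_of_int n \<le> R" "1 \<le> R"
    show "card (circle_points n) \<le> 15 * D\<^sup>2 * R powr \<epsilon>"
    proof (cases "n = 0")
      case True
      have "circle_points n = {(0, 0)}" by (auto simp: True circle_points_def)
      then have "real (card (circle_points n)) = 1" by simp
      also have "1 \<le> 15 * D\<^sup>2 * R powr \<epsilon>"
        using mult_mono[OF C1 ge_one_powr_ge_zero[of R \<epsilon>]] nn assms by simp
      finally show ?thesis .
    next
      case False
      define m where "m = nat n"
      have m: "n = int m" "m > 0" using False nn by (auto simp: m_def)
      have "real (card (circle_points n)) \<le> 15 * (real (num_divisors m))\<^sup>2"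
        using card_circle_points[OF m(2)] m(1)
        by (metis mult.assoc of_nat_mono of_nat_mult of_nat_numeral power2_eq_square)
      also have "\<dots> \<le> 15 * (D * real m powr (\<epsilon> / 2))\<^sup>2"
        using D(2)[OF m(2)] by (intro mult_left_mono power_mono) auto
      also have "\<dots> = 15 * D\<^sup>2 * real m powr \<epsilon>"
        using powr_half_sqrt_powr[of "real m" \<epsilon>] by (simp add: power_mult_distrib)
      also have "\<dots> \<le> 15 * D\<^sup>2 * R powr \<epsilon>"
        using nn m assms by (intro mult_left_mono powr_mono2) auto
      finally show ?thesis .
    qed
  qed
qed

section \<open>Fourier analysis on the torus\<close>

text \<open>For \<open>n \<noteq> 0\<close> the primitive takes equal values at the two ends, which
  are a whole number of periods apart. One period serves the space variables, several serve
  time.\<close>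

lemma has_integral_cis:
  fixes n :: int and M :: nat
  assumes "b = a + 2 * pi * M"
  shows "((\<lambda>s. cis (real_of_int n * s)) has_integral (if n = 0 then complex_of_real (b - a) else 0)) {a..b}"
proof (cases "n = 0")
  case True
  have "a \<le> b" using assms by simp
  then show ?thesis using True has_integral_const_real[of "1::complex" a b] by (simp add: scaleR_conv_of_real)
next
  case False
  have "((\<lambda>s. cis (real_of_int n * s)) has_integral
      (cis (n * b) / (\<i> * of_int n) - cis (n * a) / (\<i> * of_int n))) {a..b}"
  proof (rule fundamental_theorem_of_calculus)
    show "a \<le> b" using assms by simp
    fix s assume "s \<in> {a..b}"
    have "((\<lambda>s. exp (\<i> * of_int n * of_real s)) has_vector_derivative
        exp (\<i> * of_int n * of_real s) * (\<i> * of_int n)) (at s within {a..b})"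
      by (rule has_vector_derivative_real_field) (auto intro!: derivative_eq_intros)
    then have "((\<lambda>s. exp (\<i> * of_int n * of_real s) / (\<i> * of_int n)) has_vector_derivative
        exp (\<i> * of_int n * of_real s) * (\<i> * of_int n) / (\<i> * of_int n)) (at s within {a..b})"
      by (rule has_vector_derivative_divide)
    then show "((\<lambda>s. cis (real_of_int n * s) / (\<i> * of_int n)) has_vector_derivative cis (real_of_int n * s)) (at s within {a..b})"
      using False by (simp add: cis_conv_exp mult_ac)
  qed
  moreover have "cis (n * b) = cis (n * a)"
  proof -
    have "n * b = n * a + 2 * pi * real_of_int (n * int M)" using assms by (simp add: algebra_simps)
    then have "cis (n * b) = cis (n * a) * cis (2 * pi * real_of_int (n * int M))"
      by (simp only: cis_mult)
    then show ?thesis using cis_multiple_2pi[of "real_of_int (n * int M)"] by simp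
  qed
  ultimately show ?thesis using False by simp
qed

lemma freq_diff: "freq (k - l) = freq k - freq l"
  by (simp add: freq_def)

lemma freq_add: "freq (k + l) = freq k + freq l"
  by (simp add: freq_def)

text \<open>A compact version of \<open>torus_cell\<close>, on which continuous functions are
  integrable and iterated integration is available; it adds only boundary points.\<close>

definition closed_cell :: "(real \<times> real) set" where
  "closed_cell = cbox (0, 0) (2 * pi, 2 * pi)"

text \<open>Orthogonality of the characters: the integral factors over the two variables, and a
  factor vanishes unless its frequency is 0.\<close>

lemma integral_cell_cis:
  "integral closed_cell (\<lambda>x. cis (freq k \<bullet> x)) = (if k = 0 then complex_of_real ((2 * pi)\<^sup>2) else 0)"
proof -
  have one: "integral {0..2 * pi} (\<lambda>s. cis (real_of_int n * s)) = (if n = 0 then complex_of_real (2 * pi) else 0)" for n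
    using has_integral_cis[of "2 * pi" 0 1 n] by (auto dest!: integral_unique)
  have "integral closed_cell (\<lambda>x. cis (freq k \<bullet> x)) =
      integral (cbox 0 (2 * pi)) (\<lambda>x. integral (cbox 0 (2 * pi)) (\<lambda>y. cis (freq k \<bullet> (x, y))))"
    unfolding closed_cell_def by (rule integral_prod_continuous) (intro continuous_intros)
  also have "\<dots> = integral {0..2 * pi} (\<lambda>x. integral {0..2 * pi} (\<lambda>y. cis (fst k * x) * cis (snd k * y)))"
    by (simp add: freq_def cis_mult)
  also have "\<dots> = integral {0..2 * pi} (\<lambda>x. cis (fst k * x)) * integral {0..2 * pi} (\<lambda>y. cis (snd k * y))"
    by simp
  also have "\<dots> = (if k = 0 then complex_of_real ((2 * pi)\<^sup>2) else 0)"
    unfolding one by (cases k) (auto simp: power2_eq_square zero_prod_def)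
  finally show ?thesis .
qed

lemma integrable_lebesgue_on_subset_cbox:
  fixes f :: "'a::euclidean_space \<Rightarrow> 'b::euclidean_space"
  assumes "continuous_on (cbox a b) f" "S \<in> sets lebesgue" "S \<subseteq> cbox a b"
  shows "integrable (lebesgue_on S) f"
proof -
  have "set_integrable lebesgue S f"
    using absolutely_integrable_continuous[OF assms(1)] assms(2,3) by (rule set_integrable_subset)
  then show ?thesis using assms(2) by (simp add: integrable_restrict_space set_integrable_def)
qed

lemma torus_cell_borel: "torus_cell \<in> sets borel"
  unfolding torus_cell_def by (simp add: borel_prod[symmetric])

lemma torus_cell_lebesgue: "torus_cell \<in> sets lebesgue"
  using torus_cell_borel by (simp add: sets_completionI_sets)

lemma torus_cell_subset: "torus_cell \<subseteq> closed_cell"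
  by (auto simp: torus_cell_def closed_cell_def)

lemma integrable_torus_cell:
  fixes f :: "real \<times> real \<Rightarrow> 'b::euclidean_space"
  assumes "continuous_on UNIV f"
  shows "integrable (lebesgue_on torus_cell) f"
  using integrable_lebesgue_on_subset_cbox[OF continuous_on_subset[OF assms] torus_cell_lebesgue]
    torus_cell_subset unfolding closed_cell_def by blast

text \<open>Both cells lie between the open box and its closure, so they differ by part of the
  boundary, a null set.\<close>

lemma integral_torus_cell:
  fixes f :: "real \<times> real \<Rightarrow> 'b::euclidean_space"
  assumes "continuous_on UNIV f"
  shows "integral\<^sup>L (lebesgue_on torus_cell) f = integral closed_cell f"
proof -
  have "integral\<^sup>L (lebesgue_on torus_cell) f = integral torus_cell f"
    by (rule lebesgue_integral_eq_integral[OF integrable_torus_cell[OF assms] torus_cell_lebesgue])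
  also have "\<dots> = integral closed_cell f"
  proof (rule integral_spike_set)
    have neg: "negligible (closed_cell - box (0, 0) (2 * pi, 2 * pi))"
      unfolding closed_cell_def by (rule negligible_frontier_interval)
    have sub: "box (0, 0) (2 * pi, 2 * pi) \<subseteq> torus_cell"
      by (auto simp: torus_cell_def box_def Basis_prod_def)
    show "negligible {x \<in> closed_cell - torus_cell. f x \<noteq> 0}"
      by (rule negligible_subset[OF neg]) (use sub in auto)
    show "negligible {x \<in> torus_cell - closed_cell. f x \<noteq> 0}"
      using torus_cell_subset by (simp add: Diff_eq_empty_iff[THEN iffD2])
  qed
  finally show ?thesis .
qed

text \<open>Expand the squared distance from \<open>\<phi>\<close> to its Fourier sum
  \<open>P\<close> over \<open>\<Lambda>\<close>: the pairing of \<open>\<phi>\<close> with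
  \<open>P\<close> and the squared norm of \<open>P\<close> both equal \<open>S\<close>, so the
  squared norm of \<open>\<phi>\<close> minus \<open>S\<close> remains. The factor
  \<open>(2 * pi)\<^sup>2\<close> reflects the normalisation of
  \<open>fourier_coeff\<close>.\<close>

lemma bessel_torus:
  assumes phi: "\<phi> \<in> Lp_space 2 (lebesgue_on torus_cell)" and fin: "finite \<Lambda>"
  shows "(2 * pi)\<^sup>2 * (\<Sum>k\<in>\<Lambda>. (cmod (fourier_coeff \<phi> k))\<^sup>2)
     \<le> (LINT x|lebesgue_on torus_cell. cmod (\<phi> x) powr 2)"
proof -
  let ?M = "lebesgue_on torus_cell"
  define a where "a = fourier_coeff \<phi>"
  define e where "e = (\<lambda>k x. cis (freq k \<bullet> x))"
  define P where "P = (\<lambda>x. \<Sum>k\<in>\<Lambda>. a k * e k x)"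
  have conte: "continuous_on UNIV (e k)" for k unfolding e_def by (intro continuous_intros)
  have mphi [measurable]: "\<phi> \<in> borel_measurable ?M" and sq: "integrable ?M (\<lambda>x. (cmod (\<phi> x))\<^sup>2)"
    using phi by (auto simp: Lp_space_def)
  have one: "integrable ?M (\<lambda>x. 1::real)"
    by (rule integrable_torus_cell) (intro continuous_intros)
  \<comment> \<open>The cell has finite measure, so square integrability gives integrability; the
    Fourier coefficients are then genuine integrals and not the default 0.\<close>
  have phi1: "integrable ?M \<phi>"
  proof (rule Bochner_Integration.integrable_bound[OF Bochner_Integration.integrable_add[OF one sq] mphi])
    have "cmod (\<phi> x) \<le> 1 + (cmod (\<phi> x))\<^sup>2" for x
    proof -
      have "0 \<le> (cmod (\<phi> x) - 1)\<^sup>2" by simp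
      then have "2 * cmod (\<phi> x) \<le> 1 + (cmod (\<phi> x))\<^sup>2" by (simp add: power2_diff)
      then show ?thesis using norm_ge_zero[of "\<phi> x"] by linarith
    qed
    then show "AE x in ?M. norm (\<phi> x) \<le> norm (1 + (cmod (\<phi> x))\<^sup>2)"
      by (auto intro!: AE_I2 order_trans[OF _ abs_ge_self])
  qed
  have me [measurable]: "e k \<in> borel_measurable ?M" for k
    by (rule borel_measurable_integrable[OF integrable_torus_cell[OF conte]])
  have ie: "integrable ?M (\<lambda>x. \<phi> x * cnj (e k x))" for k
  proof (rule Bochner_Integration.integrable_bound[OF phi1])
    show "(\<lambda>x. \<phi> x * cnj (e k x)) \<in> borel_measurable ?M"
      using borel_measurable_continuous_onI[OF continuous_on_cnj[OF continuous_on_id]] by measurable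
  qed (simp add: norm_mult e_def)
  have int_e: "integral\<^sup>L ?M (\<lambda>x. \<phi> x * cnj (e k x)) = (2 * pi)\<^sup>2 * a k" for k
  proof -
    have "a k = (LINT x|?M. \<phi> x * cnj (e k x)) / complex_of_real ((2 * pi)\<^sup>2)"
      unfolding a_def fourier_coeff_def e_def by (simp add: cis_conv_exp exp_cnj mult.commute)
    then show ?thesis by simp
  qed
  have ee: "e k x * cnj (e l x) = cis (freq (k - l) \<bullet> x)" for k l x
    by (simp add: e_def cis_cnj cis_mult freq_diff inner_diff_left)
  have iee: "integrable ?M (\<lambda>x. e k x * cnj (e l x))" for k l
    unfolding ee by (rule integrable_torus_cell) (intro continuous_intros)
  have int_ee: "integral\<^sup>L ?M (\<lambda>x. e k x * cnj (e l x)) = (if k = l then (2 * pi)\<^sup>2 else 0)" for k l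
    unfolding ee
    by (subst integral_torus_cell) (auto intro!: continuous_intros simp: integral_cell_cis)
  define S where "S = (2 * pi)\<^sup>2 * (\<Sum>k\<in>\<Lambda>. (cmod (a k))\<^sup>2)"
  have aa: "cnj (a k) * a k = complex_of_real ((cmod (a k))\<^sup>2)" for k
    by (metis complex_norm_square mult.commute)
  have pP: "\<phi> x * cnj (P x) = (\<Sum>k\<in>\<Lambda>. cnj (a k) * (\<phi> x * cnj (e k x)))" for x
    by (simp add: P_def sum_distrib_left mult_ac)
  have PP: "P x * cnj (P x) = (\<Sum>k\<in>\<Lambda>. \<Sum>l\<in>\<Lambda>. (a k * cnj (a l)) * (e k x * cnj (e l x)))" for x
    by (simp add: P_def sum_product mult_ac)
  have i1: "integrable ?M (\<lambda>x. \<phi> x * cnj (P x))"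
    unfolding pP by (intro Bochner_Integration.integrable_sum integrable_mult_right ie)
  have i2: "integrable ?M (\<lambda>x. P x * cnj (P x))"
    unfolding PP by (intro Bochner_Integration.integrable_sum integrable_mult_right iee)
  have I1: "integral\<^sup>L ?M (\<lambda>x. \<phi> x * cnj (P x)) = of_real S"
  proof -
    have "integral\<^sup>L ?M (\<lambda>x. \<phi> x * cnj (P x)) = (\<Sum>k\<in>\<Lambda>. cnj (a k) * (complex_of_real ((2 * pi)\<^sup>2) * a k))"
      unfolding pP by (simp add: ie int_e)
    also have "\<dots> = of_real S"
      unfolding S_def sum_distrib_left of_real_sum of_real_mult[of "(2 * pi)\<^sup>2"] aa[symmetric]
      by (simp only: mult_ac)
    finally show ?thesis .
  qed
  have I2: "integral\<^sup>L ?M (\<lambda>x. P x * cnj (P x)) = of_real S"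
  proof -
    have "integral\<^sup>L ?M (\<lambda>x. P x * cnj (P x)) = (\<Sum>k\<in>\<Lambda>. \<Sum>l\<in>\<Lambda>. a k * cnj (a l) * (if k = l then (2 * pi)\<^sup>2 else 0))"
      unfolding PP by (simp add: iee int_ee)
    also have "\<dots> = (\<Sum>k\<in>\<Lambda>. a k * cnj (a k) * complex_of_real ((2 * pi)\<^sup>2))"
      using fin by (simp add: if_distrib cong: if_cong)
    also have "\<dots> = of_real S"
      unfolding S_def sum_distrib_left of_real_sum of_real_mult[of "(2 * pi)\<^sup>2"] aa[symmetric]
      by (simp only: mult_ac)
    finally show ?thesis .
  qed
  have pt: "(cmod (\<phi> x - P x))\<^sup>2 = (cmod (\<phi> x))\<^sup>2 - 2 * Re (\<phi> x * cnj (P x)) + Re (P x * cnj (P x))" for x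
    unfolding cmod_power2 by (simp add: power2_eq_square algebra_simps)
  have "0 \<le> integral\<^sup>L ?M (\<lambda>x. (cmod (\<phi> x - P x))\<^sup>2)" by simp
  also have "\<dots> = integral\<^sup>L ?M (\<lambda>x. (cmod (\<phi> x))\<^sup>2)
      - 2 * Re (integral\<^sup>L ?M (\<lambda>x. \<phi> x * cnj (P x))) + Re (integral\<^sup>L ?M (\<lambda>x. P x * cnj (P x)))"
    unfolding pt using sq i1 i2 by (simp del: times_complex.sel)
  also have "\<dots> = integral\<^sup>L ?M (\<lambda>x. (cmod (\<phi> x))\<^sup>2) - S"
    unfolding I1 I2 by simp
  finally have "S \<le> integral\<^sup>L ?M (\<lambda>x. (cmod (\<phi> x))\<^sup>2)" by simp
  then show ?thesis by (simp add: S_def a_def)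
qed

section \<open>Space-time trigonometric sums\<close>

text \<open>The index type is kept general so that one notion covers both the solution, indexed by
  frequencies, and its square, indexed by pairs. \<open>m\<close> gives the spatial and
  \<open>n\<close> the temporal frequency, and \<open>s\<close> stands for
  \<open>g t\<close>.\<close>

definition trig_sum ::
  "'p set \<Rightarrow> ('p \<Rightarrow> complex) \<Rightarrow> ('p \<Rightarrow> int \<times> int) \<Rightarrow> ('p \<Rightarrow> int) \<Rightarrow> real \<Rightarrow> real \<times> real \<Rightarrow> complex" where
  "trig_sum P b m n s x = (\<Sum>p\<in>P. b p * cis (freq (m p) \<bullet> x - s * real_of_int (n p)))"

lemma continuous_on_trig_sum [continuous_intros]:
  assumes "continuous_on S f" "continuous_on S h"
  shows "continuous_on S (\<lambda>z. trig_sum P b m n (f z) (h z))"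
  unfolding trig_sum_def by (intro continuous_intros assms)

lemma trig_sum_square:
  "complex_of_real ((cmod (trig_sum P b m n s x))\<^sup>2) =
     (\<Sum>p\<in>P. \<Sum>q\<in>P. b p * cnj (b q) * cis (real_of_int (n q - n p) * s) * cis (freq (m p - m q) \<bullet> x))"
proof -
  have term_eq: "(b p * cis (freq (m p) \<bullet> x - s * real_of_int (n p))) * cnj (b q * cis (freq (m q) \<bullet> x - s * real_of_int (n q)))
      = b p * cnj (b q) * cis (real_of_int (n q - n p) * s) * cis (freq (m p - m q) \<bullet> x)" for p q
  proof -
    have "cis (freq (m p) \<bullet> x - s * real_of_int (n p)) * cnj (cis (freq (m q) \<bullet> x - s * real_of_int (n q)))
        = cis (real_of_int (n q - n p) * s) * cis (freq (m p - m q) \<bullet> x)"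
      by (simp add: cis_cnj cis_mult freq_diff inner_diff_left algebra_simps)
    then show ?thesis by (metis complex_cnj_mult mult.assoc mult.left_commute)
  qed
  show ?thesis
    unfolding complex_norm_square trig_sum_def cnj_sum sum_product term_eq ..
qed

text \<open>Integration in space keeps only the pairs with equal spatial frequency; the dependence
  on \<open>s\<close> stays explicit for the integration in time.\<close>

lemma integral_cell_trig_sum:
  assumes "finite P"
  shows "complex_of_real (integral closed_cell (\<lambda>x. (cmod (trig_sum P b m n s x))\<^sup>2)) =
     (2 * pi)\<^sup>2 * (\<Sum>p\<in>P. \<Sum>q\<in>{q\<in>P. m q = m p}. b p * cnj (b q) * cis (real_of_int (n q - n p) * s))"
proof -
  have cell: "((\<lambda>x. cis (freq k \<bullet> x)) has_integral (if k = 0 then complex_of_real ((2 * pi)\<^sup>2) else 0)) closed_cell" for k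
    unfolding integral_cell_cis[symmetric] closed_cell_def
    by (intro integrable_integral integrable_continuous continuous_intros)
  have real_int: "(\<lambda>x. (cmod (trig_sum P b m n s x))\<^sup>2) integrable_on closed_cell"
    unfolding closed_cell_def by (intro integrable_continuous continuous_intros)
  have "complex_of_real (integral closed_cell (\<lambda>x. (cmod (trig_sum P b m n s x))\<^sup>2))
      = integral closed_cell (\<lambda>x. complex_of_real ((cmod (trig_sum P b m n s x))\<^sup>2))"
    using integral_linear[OF real_int bounded_linear_of_real[where 'a=complex]] by (simp add: o_def)
  also have "\<dots> = (\<Sum>p\<in>P. \<Sum>q\<in>P. b p * cnj (b q) * cis (real_of_int (n q - n p) * s) *
      (if m p - m q = 0 then complex_of_real ((2 * pi)\<^sup>2) else 0))"
    unfolding trig_sum_square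
    by (intro integral_unique has_integral_sum assms has_integral_mult_right cell)
  also have "\<dots> = (\<Sum>p\<in>P. \<Sum>q\<in>{q\<in>P. m q = m p}. b p * cnj (b q) * cis (real_of_int (n q - n p) * s) * (2 * pi)\<^sup>2)"
    using assms by (rule_tac sum.cong[OF refl], rule_tac sum.mono_neutral_cong_right) auto
  finally show ?thesis by (simp add: sum_distrib_left sum_distrib_right mult_ac)
qed

text \<open>Each product is at most half the sum of the squares. The relation
  \<open>r q = r p\<close> is symmetric, so both halves have the same sum, in which every square is
  repeated at most \<open>R\<close> times.\<close>

lemma resonant_sum_bound:
  fixes c :: "'p \<Rightarrow> real"
  assumes fin: "finite P"
    and R: "\<And>p. p \<in> P \<Longrightarrow> real (card {q\<in>P. r q = r p}) \<le> R"
  shows "(\<Sum>p\<in>P. \<Sum>q\<in>{q\<in>P. r q = r p}. c p * c q) \<le> R * (\<Sum>p\<in>P. (c p)\<^sup>2)"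
proof -
  have am: "c p * c q \<le> (c p)\<^sup>2 / 2 + (c q)\<^sup>2 / 2" for p q
    using sum_squares_bound[of "c p" "c q"] by simp
  have half: "(\<Sum>p\<in>P. \<Sum>q\<in>{q\<in>P. r q = r p}. (c p)\<^sup>2 / 2) \<le> R * (\<Sum>p\<in>P. (c p)\<^sup>2) / 2"
  proof -
    have "(\<Sum>p\<in>P. \<Sum>q\<in>{q\<in>P. r q = r p}. (c p)\<^sup>2 / 2) = (\<Sum>p\<in>P. real (card {q\<in>P. r q = r p}) * ((c p)\<^sup>2 / 2))"
      by simp
    also have "\<dots> \<le> (\<Sum>p\<in>P. R * ((c p)\<^sup>2 / 2))"
      by (intro sum_mono mult_right_mono R) auto
    finally show ?thesis by (simp add: sum_distrib_left sum_divide_distrib)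
  qed
  have swap: "(\<Sum>p\<in>P. \<Sum>q\<in>{q\<in>P. r q = r p}. (c q)\<^sup>2 / 2) = (\<Sum>p\<in>P. \<Sum>q\<in>{q\<in>P. r q = r p}. (c p)\<^sup>2 / 2)"
    by (subst sum.swap_restrict[OF fin fin]) (simp add: eq_commute)
  have "(\<Sum>p\<in>P. \<Sum>q\<in>{q\<in>P. r q = r p}. c p * c q)
      \<le> (\<Sum>p\<in>P. \<Sum>q\<in>{q\<in>P. r q = r p}. (c p)\<^sup>2 / 2 + (c q)\<^sup>2 / 2)"
    by (intro sum_mono am)
  also have "\<dots> = (\<Sum>p\<in>P. \<Sum>q\<in>{q\<in>P. r q = r p}. (c p)\<^sup>2 / 2) + (\<Sum>p\<in>P. \<Sum>q\<in>{q\<in>P. r q = r p}. (c q)\<^sup>2 / 2)"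
    by (simp only: sum.distrib)
  also have "\<dots> \<le> R * (\<Sum>p\<in>P. (c p)\<^sup>2)" using half swap by simp
  finally show ?thesis .
qed

text \<open>Integration over whole periods also removes the pairs with different temporal
  frequencies. What is left is the sum \<open>W\<close> over resonant pairs, estimated by absolute
  values and the size \<open>R\<close> of the resonance classes.\<close>

lemma time_integral_trig_sum_bound:
  fixes b :: "'p \<Rightarrow> complex"
  assumes fin: "finite P"
    and R: "\<And>p. p \<in> P \<Longrightarrow> real (card {q\<in>P. m q = m p \<and> n q = n p}) \<le> R"
  defines "H \<equiv> \<lambda>s. integral closed_cell (\<lambda>x. (cmod (trig_sum P b m n s x))\<^sup>2)"
  shows "continuous_on UNIV H"
    and "integral {- (2 * pi * real M)..2 * pi * real M} H \<le> (2 * pi)\<^sup>2 * (4 * pi * real M) * (R * (\<Sum>p\<in>P. (cmod (b p))\<^sup>2))"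
proof -
  define G where "G = (\<lambda>s. complex_of_real ((2 * pi)\<^sup>2) *
     (\<Sum>p\<in>P. \<Sum>q\<in>{q\<in>P. m q = m p}. b p * cnj (b q) * cis (real_of_int (n q - n p) * s)))"
  have HG: "complex_of_real (H s) = G s" for s
    using integral_cell_trig_sum[OF fin] by (simp add: H_def G_def)
  then have HRe: "H = (\<lambda>s. Re (G s))" by (metis Re_complex_of_real)
  have contG: "continuous_on S G" for S unfolding G_def by (intro continuous_intros)
  then show "continuous_on UNIV H" unfolding HRe by (intro continuous_intros)
  define W where "W = (\<Sum>p\<in>P. \<Sum>q\<in>{q\<in>P. m q = m p \<and> n q = n p}. b p * cnj (b q))"
  let ?J = "{- (2 * pi * real M)..2 * pi * real M}"
  have fin': "finite {q\<in>P. m q = m p}" for p using fin by simp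
  \<comment> \<open>The interval has length \<open>4 * pi * M\<close>, that is, \<open>2 * M\<close>
    periods.\<close>
  have "(G has_integral complex_of_real ((2 * pi)\<^sup>2) *
     (\<Sum>p\<in>P. \<Sum>q\<in>{q\<in>P. m q = m p}. b p * cnj (b q) *
       (if n q - n p = 0 then complex_of_real (2 * pi * real M - - (2 * pi * real M)) else 0))) ?J"
    unfolding G_def
    by (intro has_integral_sum has_integral_mult_right has_integral_cis[where M = "2 * M"] fin fin') simp
  moreover have "(\<Sum>p\<in>P. \<Sum>q\<in>{q\<in>P. m q = m p}. b p * cnj (b q) *
       (if n q - n p = 0 then complex_of_real (2 * pi * real M - - (2 * pi * real M)) else 0))
     = complex_of_real (4 * pi * real M) * W"
  proof -
    have "(\<Sum>p\<in>P. \<Sum>q\<in>{q\<in>P. m q = m p}. b p * cnj (b q) *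
       (if n q - n p = 0 then complex_of_real (2 * pi * real M - - (2 * pi * real M)) else 0))
     = (\<Sum>p\<in>P. \<Sum>q\<in>{q\<in>P. m q = m p \<and> n q = n p}. b p * cnj (b q) * complex_of_real (4 * pi * real M))"
      using fin by (rule_tac sum.cong[OF refl], rule_tac sum.mono_neutral_cong_right) auto
    then show ?thesis by (simp only: W_def flip: sum_distrib_right) (simp only: mult.commute)
  qed
  ultimately have "(G has_integral complex_of_real ((2 * pi)\<^sup>2 * (4 * pi * real M)) * W) ?J"
    by (simp only: of_real_mult[of "(2 * pi)\<^sup>2"] mult.assoc)
  then have "(H has_integral Re (complex_of_real ((2 * pi)\<^sup>2 * (4 * pi * real M)) * W)) ?J"
    unfolding HRe by (rule has_integral_Re)
  then have "integral ?J H = Re (complex_of_real ((2 * pi)\<^sup>2 * (4 * pi * real M)) * W)"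
    by (rule integral_unique)
  also have "\<dots> = (2 * pi)\<^sup>2 * (4 * pi * real M) * Re W"
    by (simp only: times_complex.sel Re_complex_of_real Im_complex_of_real mult_zero_left diff_zero)
  also have "\<dots> \<le> (2 * pi)\<^sup>2 * (4 * pi * real M) * (R * (\<Sum>p\<in>P. (cmod (b p))\<^sup>2))"
  proof (rule mult_left_mono)
    have "Re W \<le> cmod W" by (rule complex_Re_le_cmod)
    also have "\<dots> \<le> (\<Sum>p\<in>P. \<Sum>q\<in>{q\<in>P. m q = m p \<and> n q = n p}. cmod (b p) * cmod (b q))"
      unfolding W_def by (intro order_trans[OF norm_sum] sum_mono) (simp add: norm_mult)
    also have "\<dots> = (\<Sum>p\<in>P. \<Sum>q\<in>{q\<in>P. (m q, n q) = (m p, n p)}. cmod (b p) * cmod (b q))"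
      by simp
    also have "\<dots> \<le> R * (\<Sum>p\<in>P. (cmod (b p))\<^sup>2)"
      by (rule resonant_sum_bound[OF fin]) (use R in simp)
    finally show "Re W \<le> R * (\<Sum>p\<in>P. (cmod (b p))\<^sup>2)" .
  qed simp
  finally show "integral ?J H \<le> (2 * pi)\<^sup>2 * (4 * pi * real M) * (R * (\<Sum>p\<in>P. (cmod (b p))\<^sup>2))" .
qed

text \<open>Integrating first in space leaves \<open>g' t * H (g t)\<close>, exactly the integrand
  that \<open>s = g t\<close> produces from \<open>H\<close>. \<open>M\<close> is any number of
  periods large enough to cover the image of the time interval.\<close>

lemma weighted_integral_trig_sum_bound:
  fixes g g' :: "real \<Rightarrow> real"
  assumes fin: "finite P"
    and R: "\<And>p. p \<in> P \<Longrightarrow> real (card {q\<in>P. m q = m p \<and> n q = n p}) \<le> R"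
    and T: "T > 0"
    and deriv: "\<And>t. (g has_field_derivative g' t) (at t)"
    and cont: "continuous_on UNIV g'"
    and mono: "mono g"
    and M: "\<bar>g T\<bar> \<le> 2 * pi * real M" "\<bar>g (-T)\<bar> \<le> 2 * pi * real M"
  shows "integral (cbox (-T, (0, 0)) (T, (2 * pi, 2 * pi))) (\<lambda>z. g' (fst z) * (cmod (trig_sum P b m n (g (fst z)) (snd z)))\<^sup>2)
     \<le> (2 * pi)\<^sup>2 * (4 * pi * real M) * (R * (\<Sum>p\<in>P. (cmod (b p))\<^sup>2))"
proof -
  define H where "H = (\<lambda>s. integral closed_cell (\<lambda>x. (cmod (trig_sum P b m n s x))\<^sup>2))"
  have contH: "continuous_on S H" for S
    using time_integral_trig_sum_bound(1)[OF fin R] unfolding H_def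
    by (rule continuous_on_subset) auto
  have H0: "H s \<ge> 0" for s unfolding H_def
    by (intro integral_nonneg) (auto simp: closed_cell_def intro!: integrable_continuous continuous_intros)
  have contg: "continuous_on UNIV g"
    using deriv by (meson DERIV_continuous continuous_at_imp_continuous_on)
  have gf: "continuous_on A (\<lambda>z. g (fst z))" "continuous_on A (\<lambda>z. g' (fst z))" for A :: "(real \<times> real \<times> real) set"
    by (intro continuous_on_compose2[OF contg] continuous_on_compose2[OF cont] continuous_intros subset_UNIV)+
  have "integral (cbox (-T, (0, 0)) (T, (2 * pi, 2 * pi))) (\<lambda>z. g' (fst z) * (cmod (trig_sum P b m n (g (fst z)) (snd z)))\<^sup>2)
     = integral (cbox (-T) T) (\<lambda>t. integral (cbox (0, 0) (2 * pi, 2 * pi)) (\<lambda>x. g' (fst (t, x)) * (cmod (trig_sum P b m n (g (fst (t, x))) (snd (t, x))))\<^sup>2))"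
    by (rule integral_prod_continuous) (intro continuous_intros gf)
  also have "\<dots> = integral {-T..T} (\<lambda>t. g' t *\<^sub>R H (g t))"
    by (simp add: H_def closed_cell_def)
  \<comment> \<open>The substitution never divides by \<open>g'\<close>, so zeros of
    \<open>g'\<close> do no harm.\<close>
  also have "\<dots> = integral {g (-T)..g T} H"
  proof (rule integral_unique, rule has_integral_substitution[where c = "g (-T)" and d = "g T"])
    show "g ` {- T..T} \<subseteq> {g (- T)..g T}" using monoD[OF mono] by auto
    show "g (- T) \<le> g T" using monoD[OF mono] T by simp
    show "(g has_field_derivative g' t) (at t within {- T..T})" for t
      using deriv by (rule has_field_derivative_at_within)
  qed (use T contH in auto)
  \<comment> \<open>\<open>H\<close> is nonnegative, so the interval may grow to whole periods,
    where orthogonality in time applies.\<close>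
  also have "\<dots> \<le> integral {- (2 * pi * real M)..2 * pi * real M} H"
  proof (rule integral_subset_le)
    show "{g (- T)..g T} \<subseteq> {- (2 * pi * real M)..2 * pi * real M}"
      using M by (auto simp: abs_le_iff)
  qed (auto simp: H0 intro!: integrable_continuous_real contH)
  also have "\<dots> \<le> (2 * pi)\<^sup>2 * (4 * pi * real M) * (R * (\<Sum>p\<in>P. (cmod (b p))\<^sup>2))"
    unfolding H_def by (rule time_integral_trig_sum_bound(2)[OF fin R])
  finally show ?thesis .
qed

section \<open>The Strichartz estimate\<close>

text \<open>The squared length as an integer: integral temporal frequencies are what make the sums
  periodic in \<open>s\<close>.\<close>

definition freq_sq :: "int \<times> int \<Rightarrow> int" where
  "freq_sq k = (fst k)\<^sup>2 + (snd k)\<^sup>2"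

lemma norm_freq_sq: "(norm (freq k))\<^sup>2 = real_of_int (freq_sq k)"
  by (simp add: freq_def freq_sq_def norm_Pair)

lemma finite_freq_ball: "finite {k. norm (freq k) \<le> N}"
proof (rule finite_subset)
  show "{k. norm (freq k) \<le> N} \<subseteq> {-\<lfloor>N\<rfloor>..\<lfloor>N\<rfloor>} \<times> {-\<lfloor>N\<rfloor>..\<lfloor>N\<rfloor>}"
  proof
    fix k assume "k \<in> {k. norm (freq k) \<le> N}"
    then have "norm (freq k) \<le> N" by simp
    then have "\<bar>real_of_int (fst k)\<bar> \<le> N" "\<bar>real_of_int (snd k)\<bar> \<le> N"
      using norm_fst_le[of "fst (freq k)" "snd (freq k)"] norm_snd_le[of "snd (freq k)" "fst (freq k)"]
      by (auto simp: freq_def)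
    then have "\<bar>fst k\<bar> \<le> \<lfloor>N\<rfloor>" "\<bar>snd k\<bar> \<le> \<lfloor>N\<rfloor>"
      by (simp_all add: le_floor_iff)
    then show "k \<in> {-\<lfloor>N\<rfloor>..\<lfloor>N\<rfloor>} \<times> {-\<lfloor>N\<rfloor>..\<lfloor>N\<rfloor>}"
      by (cases k) (auto simp: abs_le_iff)
  qed
qed auto

text \<open>The parallelogram law turns the resonance condition into \<open>|k' - l'| = |k - l|\<close>.\<close>

lemma card_resonant_pairs:
  assumes \<Lambda>: "\<Lambda> \<subseteq> {k. norm (freq k) \<le> N}" and kl: "k \<in> \<Lambda>" "l \<in> \<Lambda>"
  obtains r where "0 \<le> r" "real_of_int r \<le> 4 * N\<^sup>2"
    "card {q \<in> \<Lambda> \<times> \<Lambda>. fst q + snd q = k + l \<and> freq_sq (fst q) + freq_sq (snd q) = freq_sq k + freq_sq l}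
       \<le> card (circle_points r)"
proof
  define r where "r = freq_sq (k - l)"
  show "0 \<le> r" by (simp add: r_def freq_sq_def)
  have "norm (freq (k - l)) \<le> 2 * N"
    using norm_triangle_ineq4[of "freq k" "freq l"] subsetD[OF \<Lambda> kl(1)] subsetD[OF \<Lambda> kl(2)]
    by (simp add: freq_diff)
  then have "(norm (freq (k - l)))\<^sup>2 \<le> (2 * N)\<^sup>2" by (intro power_mono) auto
  then show "real_of_int r \<le> 4 * N\<^sup>2" by (simp add: norm_freq_sq r_def power_mult_distrib)
  have par: "freq_sq (a - b) = 2 * (freq_sq a + freq_sq b) - freq_sq (a + b)" for a b
    by (simp add: freq_sq_def power2_eq_square algebra_simps)
  let ?A = "{q \<in> \<Lambda> \<times> \<Lambda>. fst q + snd q = k + l \<and> freq_sq (fst q) + freq_sq (snd q) = freq_sq k + freq_sq l}"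
  \<comment> \<open>A pair is recovered from its difference together with its sum, which is fixed
    here.\<close>
  have "inj_on (\<lambda>q. fst q - snd q) ?A"
  proof (rule inj_onI)
    fix q q' assume "q \<in> ?A" "q' \<in> ?A" and d: "fst q - snd q = fst q' - snd q'"
    then have s: "fst q + snd q = fst q' + snd q'" by simp
    have "fst (fst q) = fst (fst q')" "snd (fst q) = snd (fst q')" "fst (snd q) = fst (snd q')" "snd (snd q) = snd (snd q')"
      using arg_cong[OF d, of fst] arg_cong[OF d, of snd] arg_cong[OF s, of fst] arg_cong[OF s, of snd]
      by auto
    then show "q = q'" by (simp add: prod_eq_iff)
  qed
  moreover have "(\<lambda>q. fst q - snd q) ` ?A \<subseteq> circle_points r"
  proof (rule image_subsetI)
    fix q assume "q \<in> ?A"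
    then have "freq_sq (fst q - snd q) = r" unfolding r_def par by simp
    then show "fst q - snd q \<in> circle_points r"
      by (simp add: circle_points_def freq_sq_def case_prod_beta)
  qed
  ultimately show "card ?A \<le> card (circle_points r)"
    using card_inj_on_le finite_circle_points by blast
qed

text \<open>The coefficients vanish outside the finite set \<open>\<Lambda>\<close>, so the
  unconditional series is a finite sum.\<close>

lemma propagator_eq_trig_sum:
  assumes "finite \<Lambda>" "{k. fourier_coeff \<phi> k \<noteq> 0} \<subseteq> \<Lambda>"
  shows "propagator g t \<phi> x = trig_sum \<Lambda> (fourier_coeff \<phi>) (\<lambda>k. k) freq_sq (g t) x"
proof -
  have "propagator g t \<phi> x = (\<Sum>\<^sub>\<infinity>k\<in>\<Lambda>. exp (\<i> * complex_of_real (freq k \<bullet> x))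
        * exp (- \<i> * complex_of_real (g t * (norm (freq k))\<^sup>2)) * fourier_coeff \<phi> k)"
    unfolding propagator_def by (rule infsum_cong_neutral) (use assms(2) in auto)
  also have "\<dots> = (\<Sum>k\<in>\<Lambda>. exp (\<i> * complex_of_real (freq k \<bullet> x))
        * exp (- \<i> * complex_of_real (g t * (norm (freq k))\<^sup>2)) * fourier_coeff \<phi> k)"
    using assms(1) by (rule infsum_finite)
  also have "\<dots> = trig_sum \<Lambda> (fourier_coeff \<phi>) (\<lambda>k. k) freq_sq (g t) x"
    unfolding trig_sum_def norm_freq_sq
    by (intro sum.cong refl) (simp add: cis_conv_exp algebra_simps flip: exp_add)
  finally show ?thesis .
qed

text \<open>Multiplying exponentials adds frequencies. This brings the fourth power of the modulus,
  seen as the squared modulus of the square, into the form to which orthogonality applies.\<close>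

lemma trig_sum_squared:
  "(trig_sum \<Lambda> a (\<lambda>k. k) freq_sq s x)\<^sup>2 =
     trig_sum (\<Lambda> \<times> \<Lambda>) (\<lambda>q. a (fst q) * a (snd q)) (\<lambda>q. fst q + snd q) (\<lambda>q. freq_sq (fst q) + freq_sq (snd q)) s x"
  unfolding trig_sum_def power2_eq_square sum_product sum.cartesian_product
  by (intro sum.cong refl) (auto simp: cis_mult freq_add inner_add_left algebra_simps)

theorem proposition3p1:
  fixes g :: "real \<Rightarrow> real" and \<alpha> T \<epsilon> :: real and I :: "real set"
  assumes "smooth_fun g"
    and "strict_mono g"
    and "g 0 = 0" and "deriv g 0 = 0"
    and "\<alpha> > 0"
    and "\<And>j::nat. \<exists>A. \<forall>t. \<bar>(deriv ^^ j) g t\<bar> \<le> A * (1 + \<bar>t\<bar>) powr (\<alpha> - real j)"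
    and "T > 0" and "{-T<..<T} \<subseteq> I" and "I \<subseteq> {-T..T}"
    and "\<epsilon> > 0"
  shows "\<exists>C>0. \<forall>N::real. \<forall>\<phi>.
    N \<ge> 1 \<longrightarrow> \<phi> \<in> L2_torus \<longrightarrow>
    {k. fourier_coeff \<phi> k \<noteq> 0} \<subseteq> {k. norm (freq k) \<le> N} \<longrightarrow>
      (\<lambda>(t, x). complex_of_real (deriv g t powr (1 / 4)) * propagator g t \<phi> x)
        \<in> Lp_space 4 (lebesgue_on (I \<times> torus_cell)) \<and>
      Lp_norm 4 (lebesgue_on (I \<times> torus_cell))
        (\<lambda>(t, x). complex_of_real (deriv g t powr (1 / 4)) * propagator g t \<phi> x)
      \<le> C * N powr \<epsilon> * Lp_norm 2 (lebesgue_on torus_cell) \<phi>"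
proof -
  define g' where "g' = deriv g"
  have dg: "(g has_field_derivative g' t) (at t)" for t
    using assms(1)[unfolded smooth_fun_def, rule_format, of 0 t]
    by (simp add: g'_def DERIV_deriv_iff_real_differentiable)
  have contg': "continuous_on UNIV g'"
    using assms(1)[unfolded smooth_fun_def, rule_format, of 1]
    by (auto simp: g'_def intro!: continuous_at_imp_continuous_on differentiable_imp_continuous_within)
  have contg: "continuous_on UNIV g"
    using dg by (meson DERIV_continuous continuous_at_imp_continuous_on)
  have mono: "mono g" using assms(2) by (rule strict_mono_mono)
  have g'0: "g' t \<ge> 0" for t
    using mono_on_imp_deriv_nonneg[of UNIV g "g' t" t] mono dg by simp
  \<comment> \<open>\<open>M\<close> is chosen so that \<open>g\<close> maps the time interval into
    \<open>M\<close> periods on either side of 0.\<close>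
  obtain M :: nat where "max \<bar>g T\<bar> \<bar>g (-T)\<bar> / (2 * pi) \<le> real M"
    using real_arch_simple by blast
  then have M: "\<bar>g T\<bar> \<le> 2 * pi * real M" "\<bar>g (-T)\<bar> \<le> 2 * pi * real M"
    by (auto simp: field_simps)
  \<comment> \<open>The exponent \<open>2 * \<epsilon>\<close> is chosen backwards: squared radii up
    to \<open>4 * N\<^sup>2\<close> give \<open>N powr (4 * \<epsilon>)\<close>, and the fourth root
    at the end gives \<open>N powr \<epsilon>\<close>.\<close>
  obtain D :: real where D: "D \<ge> 1"
    "\<And>n R. 0 \<le> n \<Longrightarrow> real_of_int n \<le> R \<Longrightarrow> 1 \<le> R \<Longrightarrow> card (circle_points n) \<le> D * R powr (2 * \<epsilon>)"
    using card_circle_points_bound[of "2 * \<epsilon>"] assms(10) by auto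
  \<comment> \<open>The denominator offsets the square of the factor \<open>(2 * pi)\<^sup>2\<close>
    in Bessel's inequality.\<close>
  define K where "K = (2 * pi)\<^sup>2 * (4 * pi * real M) * D * 4 powr (2 * \<epsilon>) / ((2 * pi)\<^sup>2)\<^sup>2"
  have K0: "K \<ge> 0" using D(1) by (simp add: K_def)
  \<comment> \<open>\<open>K + 1\<close> in place of \<open>K\<close> makes \<open>C\<close>
    positive from \<open>K \<ge> 0\<close> alone.\<close>
  define C where "C = (K + 1) powr (1 / 4)"
  have C0: "C > 0" using K0 by (simp add: C_def)
  have I_borel: "I \<in> sets borel"
  proof -
    have "I = {-T<..<T} \<union> (I \<inter> {-T, T})" using assms(8,9) by force
    moreover have "I \<inter> {-T, T} \<in> sets borel"
      by (intro borel_closed finite_imp_closed) auto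
    ultimately show ?thesis by (metis borel_open open_greaterThanLessThan sets.Un)
  qed
  have cell_leb: "I \<times> torus_cell \<in> sets lebesgue"
    using pair_measureI[OF I_borel torus_cell_borel] unfolding borel_prod
    by (simp add: sets_completionI_sets)
  let ?B = "cbox (-T, (0, 0)) (T, (2 * pi, 2 * pi)) :: (real \<times> real \<times> real) set"
  have sub: "I \<times> torus_cell \<subseteq> ?B"
    using assms(9) torus_cell_subset by (auto simp: closed_cell_def cbox_Pair_eq)
  have gf: "continuous_on A (\<lambda>z. g (fst z))" "continuous_on A (\<lambda>z. g' (fst z))" for A :: "(real \<times> real \<times> real) set"
    by (intro continuous_on_compose2[OF contg] continuous_on_compose2[OF contg'] continuous_intros subset_UNIV)+
  show ?thesis
  proof (intro exI conjI allI impI)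
    show "C > 0" by (rule C0)
    fix N :: real and \<phi> :: "real \<times> real \<Rightarrow> complex"
    assume N: "N \<ge> 1" and phi: "\<phi> \<in> L2_torus" and supp: "{k. fourier_coeff \<phi> k \<noteq> 0} \<subseteq> {k. norm (freq k) \<le> N}"
    let ?F = "\<lambda>(t, x). complex_of_real (deriv g t powr (1 / 4)) * propagator g t \<phi> x"
    define \<Lambda> where "\<Lambda> = {k. norm (freq k) \<le> N}"
    have fin: "finite \<Lambda>" by (simp add: \<Lambda>_def finite_freq_ball)
    define a where "a = fourier_coeff \<phi>"
    define b where "b = (\<lambda>q. a (fst q) * a (snd q))"
    define m where "m = (\<lambda>q::(int \<times> int) \<times> (int \<times> int). fst q + snd q)"
    define n where "n = (\<lambda>q. freq_sq (fst q) + freq_sq (snd q))"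
    define u where "u = trig_sum \<Lambda> a (\<lambda>k. k) freq_sq"
    have prop_eq: "propagator g t \<phi> x = u (g t) x" for t x
      unfolding u_def a_def
      by (rule propagator_eq_trig_sum) (use fin supp in \<open>auto simp: \<Lambda>_def\<close>)
    have F: "?F = (\<lambda>z. complex_of_real (g' (fst z) powr (1 / 4)) * u (g (fst z)) (snd z))"
      by (auto simp: prop_eq g'_def)
    define f where "f = (\<lambda>z. g' (fst z) * (cmod (trig_sum (\<Lambda> \<times> \<Lambda>) b m n (g (fst z)) (snd z)))\<^sup>2)"
    \<comment> \<open>Where \<open>g'\<close> vanishes, the weight is still continuous because its
      exponent \<open>1 / 4\<close> is positive.\<close>
    have contF: "continuous_on A ?F" for A
      unfolding F u_def
      by (intro continuous_intros gf continuous_on_powr') (use g'0 in auto)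
    have contf: "continuous_on A f" for A
      unfolding f_def by (intro continuous_intros gf)
    have f0: "f z \<ge> 0" for z by (simp add: f_def g'0)
    \<comment> \<open>The fourth power turns the weight into \<open>g'\<close> itself and the
      modulus of \<open>u\<close> into the squared modulus of its square.\<close>
    have Ff: "norm (?F z) powr 4 = f z" for z
    proof -
      have "(u (g (fst z)) (snd z))\<^sup>2 = trig_sum (\<Lambda> \<times> \<Lambda>) b m n (g (fst z)) (snd z)"
        unfolding u_def b_def m_def n_def by (rule trig_sum_squared)
      then have "(cmod (trig_sum (\<Lambda> \<times> \<Lambda>) b m n (g (fst z)) (snd z)))\<^sup>2 = (cmod (u (g (fst z)) (snd z))) ^ 4"
        by (metis norm_power power_mult mult_2 numeral_Bit0)
      moreover have "cmod (u (g (fst z)) (snd z)) powr 4 = cmod (u (g (fst z)) (snd z)) ^ 4"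
        using powr_numeral[of "cmod (u (g (fst z)) (snd z))" "num.Bit0 (num.Bit0 num.One)"] by simp
      moreover have "(g' (fst z) powr (1 / 4)) powr 4 = g' (fst z)"
        using g'0 by (simp add: powr_powr)
      ultimately show ?thesis unfolding F f_def by (simp add: norm_mult powr_mult)
    qed
    have intf: "integrable (lebesgue_on (I \<times> torus_cell)) f"
      by (rule integrable_lebesgue_on_subset_cbox[OF contf cell_leb sub])
    \<comment> \<open>Without membership the norm bound would say nothing, since the integral of a
      non-integrable function is 0 by default.\<close>
    show "?F \<in> Lp_space 4 (lebesgue_on (I \<times> torus_cell))"
      unfolding Lp_space_def using intf Ff continuous_imp_measurable_on_sets_lebesgue[OF contF cell_leb]
      by simp
    define R where "R = D * (4 * N\<^sup>2) powr (2 * \<epsilon>)"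
    have N2: "1 \<le> N\<^sup>2" using N by (rule one_le_power)
    have R: "real (card {q \<in> \<Lambda> \<times> \<Lambda>. m q = m p \<and> n q = n p}) \<le> R" if p: "p \<in> \<Lambda> \<times> \<Lambda>" for p
    proof -
      obtain r where r: "0 \<le> r" "real_of_int r \<le> 4 * N\<^sup>2"
        "card {q \<in> \<Lambda> \<times> \<Lambda>. m q = m p \<and> n q = n p} \<le> card (circle_points r)"
        unfolding m_def n_def
        by (rule card_resonant_pairs[of \<Lambda> N "fst p" "snd p"]) (use p in \<open>auto simp: \<Lambda>_def\<close>)
      then have "real (card {q \<in> \<Lambda> \<times> \<Lambda>. m q = m p \<and> n q = n p}) \<le> real (card (circle_points r))"
        by simp
      also have "\<dots> \<le> R" unfolding R_def by (rule D(2)[OF r(1,2)]) (use N2 in simp)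
      finally show ?thesis .
    qed
    define X where "X = (LINT x|lebesgue_on torus_cell. cmod (\<phi> x) powr 2)"
    have X0: "X \<ge> 0" by (simp add: X_def)
    define A where "A = (\<Sum>k\<in>\<Lambda>. (cmod (a k))\<^sup>2)"
    have A0: "A \<ge> 0" by (simp add: A_def sum_nonneg)
    have bessel: "(2 * pi)\<^sup>2 * A \<le> X"
      unfolding A_def X_def a_def
      by (rule bessel_torus[OF _ fin]) (use phi in \<open>simp add: L2_torus_def\<close>)
    have bA: "(\<Sum>q\<in>\<Lambda> \<times> \<Lambda>. (cmod (b q))\<^sup>2) = A\<^sup>2"
      unfolding A_def power2_eq_square[of "sum _ _"] sum_product sum.cartesian_product
      by (intro sum.cong refl) (auto simp: b_def norm_mult power_mult_distrib)
    have "integral\<^sup>L (lebesgue_on (I \<times> torus_cell)) f = integral (I \<times> torus_cell) f"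
      by (rule lebesgue_integral_eq_integral[OF intf cell_leb])
    also have "\<dots> \<le> integral ?B f"
      by (rule integral_subset_le[OF sub])
        (use integrable_on_lebesgue_on[OF intf cell_leb] f0 in \<open>auto intro!: integrable_continuous contf\<close>)
    also have "\<dots> \<le> (2 * pi)\<^sup>2 * (4 * pi * real M) * (R * (\<Sum>q\<in>\<Lambda> \<times> \<Lambda>. (cmod (b q))\<^sup>2))"
      unfolding f_def
      by (rule weighted_integral_trig_sum_bound[OF _ R assms(7) dg contg' mono M]) (use fin in auto)
    also have "\<dots> = K * N powr (4 * \<epsilon>) * ((2 * pi)\<^sup>2 * A)\<^sup>2"
    proof -
      have "N powr (4 * \<epsilon>) = (N\<^sup>2) powr (2 * \<epsilon>)"
        using N by (simp add: powr_powr flip: powr_numeral)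
      then have "R = D * 4 powr (2 * \<epsilon>) * N powr (4 * \<epsilon>)"
        by (simp add: R_def powr_mult)
      then show ?thesis unfolding bA K_def by (simp add: power_mult_distrib)
    qed
    \<comment> \<open>Bessel's inequality enters squared, because the coefficients of the square sum
      to \<open>A\<^sup>2\<close>.\<close>
    also have "\<dots> \<le> (K + 1) * N powr (4 * \<epsilon>) * X\<^sup>2"
      using bessel A0 K0 by (intro mult_mono power_mono) auto
    finally have bound: "integral\<^sup>L (lebesgue_on (I \<times> torus_cell)) f \<le> (K + 1) * N powr (4 * \<epsilon>) * X\<^sup>2" .
    have "Lp_norm 4 (lebesgue_on (I \<times> torus_cell)) ?F = (integral\<^sup>L (lebesgue_on (I \<times> torus_cell)) f) powr (1 / 4)"
      unfolding Lp_norm_def Ff ..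
    also have "\<dots> \<le> ((K + 1) * N powr (4 * \<epsilon>) * X\<^sup>2) powr (1 / 4)"
      by (rule powr_mono2[OF _ _ bound]) (auto intro!: integral_nonneg_AE simp: f0)
    \<comment> \<open>\<open>X\<close> is the squared norm of \<open>\<phi>\<close>, so the fourth
      root of \<open>X\<^sup>2\<close> is the norm to the first power.\<close>
    also have "\<dots> = C * N powr \<epsilon> * X powr (1 / 2)"
    proof -
      have "(X\<^sup>2) powr (1 / 4) = X powr (1 / 2)"
        using X0 by (simp add: powr_powr flip: powr_numeral)
      then show ?thesis using K0 X0 by (simp add: C_def powr_mult powr_powr)
    qed
    also have "\<dots> = C * N powr \<epsilon> * Lp_norm 2 (lebesgue_on torus_cell) \<phi>"
      by (simp add: Lp_norm_def X_def)
    finally show "Lp_norm 4 (lebesgue_on (I \<times> torus_cell)) ?F \<le> C * N powr \<epsilon> * Lp_norm 2 (lebesgue_on torus_cell) \<phi>" .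
  qed
qed

end
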